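(* Let $(\mathfrak h,[\cdot,\cdot]_{\mathfrak h})$ be a Leibniz algebra. Then $(\mathfrak h,\Pi(\mathfrak h),(\mathrm{ad}^L,\mathrm{ad}^R),l_2)$ is a strict Leibniz 2-algebra, where the differential $\mathfrak h\to\Pi(\mathfrak h)$ is $\alpha\mapsto(\mathrm{ad}^L_\alpha,\mathrm{ad}^R_\alpha)$ and $l_2$ is given, for $(D^L_i,D^R_i),(D^L,D^R)\in\Pi(\mathfrak h)$ and $\alpha\in\mathfrak h$, by $$l_2((D^L_1,D^R_1),(D^L_2,D^R_2))=([D^L_1,D^L_2],[D^L_1,D^R_2]),\quad l_2((D^L,D^R),\alpha)=D^L\alpha,\quad l_2(\alpha,(D^L,D^R))=D^R\alpha.$$
   Context: All vector spaces are over a fixed ground field. A (left) Leibniz algebra is a vector space with a bilinear bracket satisfying $[x,[y,z]]=[[x,y],z]+[y,[x,z]]$. $\mathrm{ad}^L_\alpha(\beta)=[\alpha,\beta]_{\mathfrak h}$, $\mathrm{ad}^R_\alpha(\beta)=[\beta,\alpha]_{\mathfrak h}$; $[D_1,D_2]=D_1D_2-D_2D_1$ for endomorphisms. $\mathrm{Der}^L(\mathfrak h)=\{D\in\mathfrak{gl}(\mathfrak h): D[\alpha,\beta]_{\mathfrak h}=[D\alpha,\beta]_{\mathfrak h}+[\alpha,D\beta]_{\mathfrak h}\}$, $\mathrm{Der}^R(\mathfrak h)=\{D\in\mathfrak{gl}(\mathfrak h): D[\alpha,\beta]_{\mathfrak h}=[\alpha,D\beta]_{\mathfrak h}-[\beta,D\alpha]_{\mathfrak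 h}\}$, $\mathfrak{Der}(\mathfrak h)=\mathrm{Der}^L(\mathfrak h)\oplus\mathrm{Der}^R(\mathfrak h)$. $\Delta(\mathfrak h)=\mathrm{span}\{[\alpha,\alpha]_{\mathfrak h}:\alpha\in\mathfrak h\}$ and $\Pi(\mathfrak h)=\{(D^L,D^R)\in\mathfrak{Der}(\mathfrak h): D^L\alpha+D^R\alpha\in\Delta(\mathfrak h)\ \forall\alpha\in\mathfrak h\}$, which contains $(\mathrm{ad}^L_\alpha,\mathrm{ad}^R_\alpha)$ for all $\alpha\in\mathfrak h$. A Leibniz 2-algebra $(V_1,V_0,\mathrm d,l_2,l_3)$ consists of a linear map $\mathrm d:V_1\to V_0$, bilinear maps $l_2:V_i\times V_j\to V_{i+j}$ ($0\le i+j\le1$) and a trilinear map $l_3:V_0^3\to V_1$ such that for $w,x,y,z\in V_0$, $m,n\in V_1$: (a) $\mathrm dl_2(x,m)=l_2(x,\mathrm dm)$; (b) $\mathrm dl_2(m,x)=l_2(\mathrm dm,x)$; (c) $l_2(\mathrm dm,n)=l_2(m,\mathrm dn)$; (d) $\mathrm dl_3(x,y,z)=l_2(x,l_2(y,z))-l_2(l_2(x,y),z)-l_2(y,l_2(x,z))$; (e1) $l_3(x,y,\mathrm dm)=l_2(x,l_2(y,m))-l_2(l_2(x,y),m)-l_2(y,l_2(x,m))$; (e2) $l_3(x,\mathrm dm,y)=l_2(x,l_2(m,y))-l_2(l_2(x,m),y)-l_2(m,l_2(x,y))$; (e3) $l_3(\mathrm dm,x,y)=l_2(m,l_2(x,y))-l_2(l_2(m,x),y)-l_2(x,l_2(m,y))$;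 (f) $l_2(w,l_3(x,y,z))-l_2(x,l_3(w,y,z))+l_2(y,l_3(w,x,z))+l_2(l_3(w,x,y),z)-l_3(l_2(w,x),y,z)-l_3(x,l_2(w,y),z)-l_3(x,y,l_2(w,z))+l_3(w,l_2(x,y),z)+l_3(w,y,l_2(x,z))-l_3(w,x,l_2(y,z))=0$. It is strict if $l_3=0$; then it is denoted $(V_1,V_0,\mathrm d,l_2)$. *)

theory Defs
  imports Complex_Main "HOL-Library.Function_Algebras" "HOL-Library.Product_Plus"
begin

text \<open>
  Linear, bilinear and trilinear maps between subspaces of ambient vector spaces. The space
  \<open>\<Pi>(h)\<close> below is a subspace of \<open>gl(h) \<oplus> gl(h)\<close> and not a type, so (multi)linearity is
  only required on carriers; in particular the values must lie in the target carrier.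
\<close>

definition linear_on ::
  "('k::field \<Rightarrow> 'a \<Rightarrow> 'a) \<Rightarrow> ('k \<Rightarrow> 'b \<Rightarrow> 'b) \<Rightarrow> 'a::ab_group_add set \<Rightarrow> 'b::ab_group_add set
    \<Rightarrow> ('a \<Rightarrow> 'b) \<Rightarrow> bool"
  where "linear_on sA sB A B f \<longleftrightarrow>
    (\<forall>x\<in>A. f x \<in> B) \<and>
    (\<forall>x\<in>A. \<forall>y\<in>A. f (x + y) = f x + f y) \<and>
    (\<forall>c. \<forall>x\<in>A. f (sA c x) = sB c (f x))"

definition bilinear_on ::
  "('k::field \<Rightarrow> 'a \<Rightarrow> 'a) \<Rightarrow> ('k \<Rightarrow> 'b \<Rightarrow> 'b) \<Rightarrow> ('k \<Rightarrow> 'c \<Rightarrow> 'c) \<Rightarrow> 'a::ab_group_add set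
    \<Rightarrow> 'b::ab_group_add set \<Rightarrow> 'c::ab_group_add set \<Rightarrow> ('a \<Rightarrow> 'b \<Rightarrow> 'c) \<Rightarrow> bool"
  where "bilinear_on sA sB sC A B C f \<longleftrightarrow>
    (\<forall>x\<in>A. linear_on sB sC B C (\<lambda>y. f x y)) \<and>
    (\<forall>y\<in>B. linear_on sA sC A C (\<lambda>x. f x y))"

definition trilinear_on ::
  "('k::field \<Rightarrow> 'a \<Rightarrow> 'a) \<Rightarrow> ('k \<Rightarrow> 'b \<Rightarrow> 'b) \<Rightarrow> 'a::ab_group_add set \<Rightarrow> 'b::ab_group_add set
    \<Rightarrow> ('a \<Rightarrow> 'a \<Rightarrow> 'a \<Rightarrow> 'b) \<Rightarrow> bool"
  where "trilinear_on sA sB A B f \<longleftrightarrow>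
    (\<forall>y\<in>A. \<forall>z\<in>A. linear_on sA sB A B (\<lambda>x. f x y z)) \<and>
    (\<forall>x\<in>A. \<forall>z\<in>A. linear_on sA sB A B (\<lambda>y. f x y z)) \<and>
    (\<forall>x\<in>A. \<forall>y\<in>A. linear_on sA sB A B (\<lambda>z. f x y z))"

text \<open>
  Leibniz 2-algebras. The spaces \<open>V1\<close> and \<open>V0\<close> are subspaces of ambient vector spaces with
  scalar multiplications \<open>s1\<close> and \<open>s0\<close>. The family \<open>l\<^sub>2 : V\<^sub>i \<times> V\<^sub>j \<rightarrow> V\<^sub>i\<^sub>+\<^sub>j\<close>
  (\<open>0 \<le> i + j \<le> 1\<close>) is given by its components \<open>l00\<close>, \<open>l01\<close>, \<open>l10\<close>, indexed by \<open>(i, j)\<close>.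
\<close>

locale leibniz_2_algebra =
  vector_space_pair s1 s0
  for s1 :: "'k::field \<Rightarrow> 'b::ab_group_add \<Rightarrow> 'b"
    and s0 :: "'k \<Rightarrow> 'a::ab_group_add \<Rightarrow> 'a" +
  fixes V1 :: "'b set"
    and V0 :: "'a set"
    and d :: "'b \<Rightarrow> 'a"
    and l00 :: "'a \<Rightarrow> 'a \<Rightarrow> 'a"
    and l01 :: "'a \<Rightarrow> 'b \<Rightarrow> 'b"
    and l10 :: "'b \<Rightarrow> 'a \<Rightarrow> 'b"
    and l3 :: "'a \<Rightarrow> 'a \<Rightarrow> 'a \<Rightarrow> 'b"
  assumes subspace_V1: "vs1.subspace V1"
    and subspace_V0: "vs2.subspace V0"
    and linear_d: "linear_on s1 s0 V1 V0 d"
    and bilinear_l00: "bilinear_on s0 s0 s0 V0 V0 V0 l00"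
    and bilinear_l01: "bilinear_on s0 s1 s1 V0 V1 V1 l01"
    and bilinear_l10: "bilinear_on s1 s0 s1 V1 V0 V1 l10"
    and trilinear_l3: "trilinear_on s0 s1 V0 V1 l3"
    and eq_a: "\<lbrakk>x \<in> V0; m \<in> V1\<rbrakk> \<Longrightarrow> d (l01 x m) = l00 x (d m)"
    and eq_b: "\<lbrakk>x \<in> V0; m \<in> V1\<rbrakk> \<Longrightarrow> d (l10 m x) = l00 (d m) x"
    and eq_c: "\<lbrakk>m \<in> V1; n \<in> V1\<rbrakk> \<Longrightarrow> l01 (d m) n = l10 m (d n)"
    and eq_d: "\<lbrakk>x \<in> V0; y \<in> V0; z \<in> V0\<rbrakk> \<Longrightarrow>
      d (l3 x y z) = l00 x (l00 y z) - l00 (l00 x y) z - l00 y (l00 x z)"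
    and eq_e1: "\<lbrakk>x \<in> V0; y \<in> V0; m \<in> V1\<rbrakk> \<Longrightarrow>
      l3 x y (d m) = l01 x (l01 y m) - l01 (l00 x y) m - l01 y (l01 x m)"
    and eq_e2: "\<lbrakk>x \<in> V0; y \<in> V0; m \<in> V1\<rbrakk> \<Longrightarrow>
      l3 x (d m) y = l01 x (l10 m y) - l10 (l01 x m) y - l10 m (l00 x y)"
    and eq_e3: "\<lbrakk>x \<in> V0; y \<in> V0; m \<in> V1\<rbrakk> \<Longrightarrow>
      l3 (d m) x y = l10 m (l00 x y) - l10 (l10 m x) y - l01 x (l10 m y)"
    and eq_f: "\<lbrakk>w \<in> V0; x \<in> V0; y \<in> V0; z \<in> V0\<rbrakk> \<Longrightarrow>
      l01 w (l3 x y z) - l01 x (l3 w y z) + l01 y (l3 w x z) + l10 (l3 w x y) z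
      - l3 (l00 w x) y z - l3 x (l00 w y) z - l3 x y (l00 w z)
      + l3 w (l00 x y) z + l3 w y (l00 x z) - l3 w x (l00 y z) = 0"

definition strict_leibniz_2_algebra ::
  "('k::field \<Rightarrow> 'b::ab_group_add \<Rightarrow> 'b) \<Rightarrow> ('k \<Rightarrow> 'a::ab_group_add \<Rightarrow> 'a) \<Rightarrow> 'b set \<Rightarrow> 'a set
    \<Rightarrow> ('b \<Rightarrow> 'a) \<Rightarrow> ('a \<Rightarrow> 'a \<Rightarrow> 'a) \<Rightarrow> ('a \<Rightarrow> 'b \<Rightarrow> 'b) \<Rightarrow> ('b \<Rightarrow> 'a \<Rightarrow> 'b) \<Rightarrow> bool"
  where "strict_leibniz_2_algebra s1 s0 V1 V0 d l00 l01 l10 \<longleftrightarrow>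
    leibniz_2_algebra s1 s0 V1 V0 d l00 l01 l10 (\<lambda>x y z. 0)"

definition commutator :: "('h::ab_group_add \<Rightarrow> 'h) \<Rightarrow> ('h \<Rightarrow> 'h) \<Rightarrow> 'h \<Rightarrow> 'h"
  where "commutator D1 D2 = (D1 \<circ> D2) - (D2 \<circ> D1)"

text \<open>Left Leibniz algebras; the underlying vector space is the whole type \<open>'h\<close>.\<close>

locale leibniz_algebra =
  vector_space scale
  for scale :: "'k::field \<Rightarrow> 'h::ab_group_add \<Rightarrow> 'h" +
  fixes br :: "'h \<Rightarrow> 'h \<Rightarrow> 'h"
  assumes linear_br_right: "Vector_Spaces.linear scale scale (\<lambda>y. br x y)"
    and linear_br_left: "Vector_Spaces.linear scale scale (\<lambda>x. br x y)"
    and leibniz: "br x (br y z) = br (br x y) z + br y (br x z)"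
begin

definition adL :: "'h \<Rightarrow> 'h \<Rightarrow> 'h"
  where "adL \<alpha> = (\<lambda>\<beta>. br \<alpha> \<beta>)"

definition adR :: "'h \<Rightarrow> 'h \<Rightarrow> 'h"
  where "adR \<alpha> = (\<lambda>\<beta>. br \<beta> \<alpha>)"

definition gl :: "('h \<Rightarrow> 'h) set"
  where "gl = {D. Vector_Spaces.linear scale scale D}"

definition DerL :: "('h \<Rightarrow> 'h) set"
  where "DerL = {D \<in> gl. \<forall>\<alpha> \<beta>. D (br \<alpha> \<beta>) = br (D \<alpha>) \<beta> + br \<alpha> (D \<beta>)}"

definition DerR :: "('h \<Rightarrow> 'h) set"
  where "DerR = {D \<in> gl. \<forall>\<alpha> \<beta>. D (br \<alpha> \<beta>) = br \<alpha> (D \<beta>) - br \<beta> (D \<alpha>)}"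

text \<open>The direct sum \<open>DerL \<oplus> DerR\<close> is external: its elements are pairs.\<close>

definition Der :: "(('h \<Rightarrow> 'h) \<times> ('h \<Rightarrow> 'h)) set"
  where "Der = DerL \<times> DerR"

definition Delta :: "'h set"
  where "Delta = span {br \<alpha> \<alpha> | \<alpha>. True}"

definition PiDer :: "(('h \<Rightarrow> 'h) \<times> ('h \<Rightarrow> 'h)) set"
  where "PiDer = {(DL, DR) \<in> Der. \<forall>\<alpha>. DL \<alpha> + DR \<alpha> \<in> Delta}"

text \<open>
  Scalar multiplication on pairs of maps; addition of such pairs is the pointwise and
  componentwise one of the library instances for \<open>fun\<close> and \<open>prod\<close>.
\<close>

definition pair_scale :: "'k \<Rightarrow> ('h \<Rightarrow> 'h) \<times> ('h \<Rightarrow> 'h) \<Rightarrow> ('h \<Rightarrow> 'h) \<times> ('h \<Rightarrow> 'h)"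
  where "pair_scale c = (\<lambda>(DL, DR). (\<lambda>\<alpha>. scale c (DL \<alpha>), \<lambda>\<alpha>. scale c (DR \<alpha>)))"

definition ad :: "'h \<Rightarrow> ('h \<Rightarrow> 'h) \<times> ('h \<Rightarrow> 'h)"
  where "ad \<alpha> = (adL \<alpha>, adR \<alpha>)"

end

definition l2_DD ::
  "('h::ab_group_add \<Rightarrow> 'h) \<times> ('h \<Rightarrow> 'h) \<Rightarrow> ('h \<Rightarrow> 'h) \<times> ('h \<Rightarrow> 'h) \<Rightarrow> ('h \<Rightarrow> 'h) \<times> ('h \<Rightarrow> 'h)"
  where "l2_DD = (\<lambda>(DL1, DR1) (DL2, DR2). (commutator DL1 DL2, commutator DL1 DR2))"

definition l2_Dh :: "('h \<Rightarrow> 'h) \<times> ('h \<Rightarrow> 'h) \<Rightarrow> 'h \<Rightarrow> 'h"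
  where "l2_Dh = (\<lambda>(DL, DR) \<alpha>. DL \<alpha>)"

definition l2_hD :: "'h \<Rightarrow> ('h \<Rightarrow> 'h) \<times> ('h \<Rightarrow> 'h) \<Rightarrow> 'h"
  where "l2_hD = (\<lambda>\<alpha> (DL, DR). DR \<alpha>)"

end

theory Submission
  imports Defs
begin

text \<open>
  Nearly all of the axioms of a strict Leibniz 2-algebra only restate that \<open>D\<^sup>L\<close> and \<open>D\<^sup>R\<close>
  are left and right derivations, or that commutators of endomorphisms satisfy the Jacobi
  identity (in its left Leibniz form). Two axioms are different: \<open>d l\<^sub>2(m, x) = l\<^sub>2(d m, x)\<close> and
  \<open>l\<^sub>2(m, l\<^sub>2(x, y)) = l\<^sub>2(l\<^sub>2(m, x), y) + l\<^sub>2(x, l\<^sub>2(m, y))\<close> can fail for pairs in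
  \<open>Der(h)\<close>, and they are why one restricts to \<open>\<Pi>(h)\<close>.

  The point is that \<open>\<Delta>(h)\<close>, the span of the squares, is annihilated in two ways: it lies in the
  left centre of \<open>h\<close> (\<open>br_Delta_left\<close>), since the Leibniz identity for \<open>x = y\<close> gives
  \<open>[[x,x],z] = 0\<close>, and it lies in the kernel of every right derivation (\<open>DerR_Delta\<close>),
  since the two terms of \<open>D[\<alpha>,\<alpha>]\<close> cancel. The left component of
  \<open>d l\<^sub>2(m, x) - l\<^sub>2(d m, x)\<close> is left multiplication by \<open>D\<^sup>L m + D\<^sup>R m\<close>, where
  \<open>x = (D\<^sup>L, D\<^sup>R)\<close>, and the left-hand side minus the right-hand side of the second axiom is
  \<open>-D\<^sub>y\<^sup>R (D\<^sub>x\<^sup>L m + D\<^sub>x\<^sup>R m)\<close>. As \<open>D\<^sup>L m + D\<^sup>R m \<in> \<Delta>(h)\<close> for pairs in \<open>\<Pi>(h)\<close>,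
  both vanish.

  That the operations stay inside \<open>\<Pi>(h)\<close> uses one more fact: left derivations map \<open>\<Delta>(h)\<close>
  into itself (\<open>DerL_Delta\<close>).
\<close>

lemma commutator_apply: "commutator D E a = D (E a) - E (D a)"
  by (simp add: commutator_def)

text \<open>
  The form in which the Jacobi identity of \<open>gl(h)\<close> enters: both components of the left Leibniz
  rule for \<open>l2_DD\<close> are instances, with \<open>F\<close> a left derivation in one and a right one in the other.
\<close>

lemma commutator_leibniz:
  assumes "additive D" "additive E" "additive F"
  shows "commutator D (commutator E F) =
    commutator (commutator D E) F + commutator E (commutator D F)"
  by (rule ext)
    (simp add: commutator_apply additive.diff[OF assms(1)] additive.diff[OF assms(2)]
      additive.diff[OF assms(3)])

context leibniz_algebra
begin

lemma br_simps:
  "br (x + y) z = br x z + br y z" "br x (y + z) = br x y + br x z"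
  "br (x - y) z = br x z - br y z" "br x (y - z) = br x y - br x z"
  "br (- x) z = - br x z" "br x (- z) = - br x z"
  "br (scale c x) z = scale c (br x z)" "br x (scale c z) = scale c (br x z)"
  "br 0 z = 0" "br x 0 = 0"
proof -
  interpret L: Vector_Spaces.linear scale scale "\<lambda>x. br x z" for z
    by (rule linear_br_left)
  interpret R: Vector_Spaces.linear scale scale "\<lambda>z. br x z" for x
    by (rule linear_br_right)
  show "br (x + y) z = br x z + br y z" "br x (y + z) = br x y + br x z"
    "br (x - y) z = br x z - br y z" "br x (y - z) = br x y - br x z"
    "br (- x) z = - br x z" "br x (- z) = - br x z"
    "br (scale c x) z = scale c (br x z)" "br x (scale c z) = scale c (br x z)"
    "br 0 z = 0" "br x 0 = 0"
    by (rule L.add R.add L.diff R.diff L.neg R.neg L.scale R.scale L.zero R.zero)+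
qed

lemma gl_iff:
  "D \<in> gl \<longleftrightarrow> (\<forall>x y. D (x + y) = D x + D y) \<and> (\<forall>c x. D (scale c x) = scale c (D x))"
  unfolding gl_def using vector_space_axioms
  by (auto simp: Vector_Spaces.linear_def module_hom_def module_hom_axioms_def
      vector_space_def module_def)

lemma gl_additive: "D \<in> gl \<Longrightarrow> additive D"
  by (simp add: gl_iff additive_def)

lemma gl_diff: "D \<in> gl \<Longrightarrow> D (x - y) = D x - D y"
  by (rule additive.diff[OF gl_additive])

lemma gl_commutator: "D \<in> gl \<Longrightarrow> E \<in> gl \<Longrightarrow> commutator D E \<in> gl"
  by (simp add: gl_iff commutator_apply scale_right_diff_distrib)

lemma subspace_kernel:
  assumes "D \<in> gl" shows "subspace {x. D x = 0}"
proof -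
  interpret additive D using assms by (rule gl_additive)
  show ?thesis using assms by (auto simp: subspace_def gl_iff zero)
qed

lemma subspace_Delta: "subspace Delta"
  unfolding Delta_def by (rule subspace_span)

lemma square_in_Delta: "br a a \<in> Delta"
  unfolding Delta_def by (rule span_base) blast

text \<open>Polarization of the squares.\<close>

lemma symmetrized_br_in_Delta: "br a b + br b a \<in> Delta"
proof -
  have "br a b + br b a = br (a + b) (a + b) - br a a - br b b"
    by (simp add: br_simps)
  then show ?thesis
    by (simp add: subspace_diff[OF subspace_Delta] square_in_Delta)
qed

text \<open>The left centre contains the squares by the Leibniz identity for \<open>x = y\<close>.\<close>

lemma br_Delta_left:
  assumes "z \<in> Delta" shows "br z y = 0"
proof -
  have "(\<lambda>x. br x y) \<in> gl"
    by (simp add: gl_def linear_br_left)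
  moreover have "br (br a a) y = 0" for a
    using leibniz[of a a y] by simp
  ultimately show ?thesis
    using span_minimal[OF _ subspace_kernel, of "{br a a | a. True}" "\<lambda>x. br x y"] assms
    by (auto simp: Delta_def)
qed

lemma DerR_Delta:
  assumes "D \<in> DerR" "z \<in> Delta" shows "D z = 0"
proof -
  have "D \<in> gl" "D (br a a) = 0" for a
    using assms(1) by (auto simp: DerR_def)
  then show ?thesis
    using span_minimal[OF _ subspace_kernel, of "{br a a | a. True}" D] assms(2)
    by (auto simp: Delta_def)
qed

text \<open>A left derivation sends the square of \<open>a\<close> to a polarized square in \<open>a\<close> and \<open>D a\<close>.\<close>

lemma DerL_Delta:
  assumes "D \<in> DerL" "z \<in> Delta" shows "D z \<in> Delta"
proof -
  have D: "D \<in> gl" and sq: "D (br a a) \<in> Delta" for a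
    using assms(1) symmetrized_br_in_Delta by (auto simp: DerL_def)
  have "subspace {x. D x \<in> Delta}"
    using D additive.zero[OF gl_additive[OF D]] subspace_Delta
    by (auto simp: subspace_def gl_iff)
  then show ?thesis
    using span_minimal[of "{br a a | a. True}" "{x. D x \<in> Delta}"] sq assms(2)
    by (auto simp: Delta_def)
qed

lemma DerL_commutator:
  "D \<in> DerL \<Longrightarrow> E \<in> DerL \<Longrightarrow> commutator D E \<in> DerL"
  by (auto simp: DerL_def gl_commutator)
    (simp add: commutator_apply gl_iff br_simps)

text \<open>\<open>Der\<^sup>R(h)\<close> is a module over the Lie algebra \<open>Der\<^sup>L(h)\<close>.\<close>

lemma DerR_commutator:
  assumes "D \<in> DerL" "E \<in> DerR" shows "commutator D E \<in> DerR"
proof -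
  have gl: "D \<in> gl" "E \<in> gl"
    using assms by (auto simp: DerL_def DerR_def)
  have "D (x - y) = D x - D y" "E (x + y) = E x + E y" for x y
    using gl by (simp_all add: gl_diff gl_iff)
  then have "commutator D E (br a b) = br a (commutator D E b) - br b (commutator D E a)" for a b
    using assms by (simp add: DerL_def DerR_def commutator_apply br_simps)
  then show ?thesis
    by (simp add: DerR_def gl_commutator gl)
qed

lemma PiDer_iff:
  "(DL, DR) \<in> PiDer \<longleftrightarrow> DL \<in> DerL \<and> DR \<in> DerR \<and> (\<forall>a. DL a + DR a \<in> Delta)"
  by (auto simp: PiDer_def Der_def)

lemma PiDer_ad: "ad a \<in> PiDer"
proof -
  have "adL a \<in> gl" "adR a \<in> gl"
    by (simp_all add: gl_iff adL_def adR_def br_simps)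
  moreover have "adL a (br b c) = br (adL a b) c + br b (adL a c)"
    "adR a (br b c) = br b (adR a c) - br c (adR a b)" for b c
    using leibniz[of a b c] leibniz[of b c a] by (simp_all add: adL_def adR_def)
  ultimately have "adL a \<in> DerL" "adR a \<in> DerR"
    by (auto simp: DerL_def DerR_def)
  then show ?thesis
    by (simp add: ad_def PiDer_iff adL_def adR_def symmetrized_br_in_Delta)
qed

text \<open>
  The sum of the two components of \<open>l2_DD\<close> is \<open>D\<^sub>1\<^sup>L \<circ> S - S \<circ> D\<^sub>1\<^sup>L\<close> with \<open>S = D\<^sub>2\<^sup>L + D\<^sub>2\<^sup>R\<close>, whose
  values lie in \<open>\<Delta>(h)\<close>, a subspace stable under \<open>D\<^sub>1\<^sup>L\<close>.
\<close>

lemma PiDer_l2_DD: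
  assumes "x \<in> PiDer" "y \<in> PiDer" shows "l2_DD x y \<in> PiDer"
proof -
  obtain L1 R1 L2 R2 where xy: "x = (L1, R1)" "y = (L2, R2)"
    by (metis surj_pair)
  have D: "L1 \<in> DerL" "L2 \<in> DerL" "R2 \<in> DerR" "\<And>a. L2 a + R2 a \<in> Delta"
    using assms by (auto simp: xy PiDer_iff)
  have "commutator L1 L2 a + commutator L1 R2 a \<in> Delta" for a
  proof -
    have "commutator L1 L2 a + commutator L1 R2 a
        = L1 (L2 a + R2 a) - (L2 (L1 a) + R2 (L1 a))"
      using D(1) by (simp add: commutator_apply DerL_def gl_iff)
    then show ?thesis
      by (simp add: subspace_diff[OF subspace_Delta] DerL_Delta D)
  qed
  then show ?thesis
    by (simp add: xy l2_DD_def PiDer_iff DerL_commutator DerR_commutator D)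
qed

lemma vector_space_pair_scale: "vector_space pair_scale"
  by unfold_locales
    (auto simp: pair_scale_def fun_eq_iff scale_right_distrib scale_left_distrib)

lemma subspace_PiDer: "module.subspace pair_scale PiDer"
proof -
  interpret P: vector_space pair_scale by (rule vector_space_pair_scale)
  have "0 \<in> PiDer"
    by (simp add: zero_prod_def PiDer_iff DerL_def DerR_def gl_iff br_simps
        subspace_0[OF subspace_Delta])
  moreover have "x + y \<in> PiDer" if "x \<in> PiDer" "y \<in> PiDer" for x y
  proof -
    obtain L1 R1 L2 R2 where xy: "x = (L1, R1)" "y = (L2, R2)"
      by (metis surj_pair)
    have "(L1 + L2) a + (R1 + R2) a \<in> Delta" for a
      using that subspace_add[OF subspace_Delta, of "L1 a + R1 a" "L2 a + R2 a"]
      by (simp add: xy PiDer_iff algebra_simps)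
    then show ?thesis
      using that
      by (simp add: xy PiDer_iff DerL_def DerR_def gl_iff br_simps scale_right_distrib)
  qed
  moreover have "pair_scale c x \<in> PiDer" if "x \<in> PiDer" for c x
  proof -
    obtain L R where x: "x = (L, R)" by (metis surj_pair)
    have "scale c (L a) + scale c (R a) \<in> Delta" for a
      using that subspace_scale[OF subspace_Delta, of "L a + R a" c]
      by (simp add: x PiDer_iff scale_right_distrib)
    then show ?thesis
      using that
      by (simp add: x pair_scale_def PiDer_iff DerL_def DerR_def gl_iff br_simps
          scale_right_distrib scale_right_diff_distrib mult.commute)
  qed
  ultimately show ?thesis by (simp add: P.subspace_def)
qed

lemma linear_ad: "linear_on scale pair_scale UNIV PiDer ad"
  by (simp add: linear_on_def PiDer_ad)
    (simp add: ad_def adL_def adR_def pair_scale_def fun_eq_iff br_simps)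

lemma bilinear_l2_DD:
  "bilinear_on pair_scale pair_scale pair_scale PiDer PiDer PiDer l2_DD"
  by (simp add: bilinear_on_def linear_on_def PiDer_l2_DD)
    (auto simp: l2_DD_def PiDer_iff pair_scale_def DerL_def DerR_def gl_iff fun_eq_iff
      commutator_apply scale_right_diff_distrib)

lemma bilinear_l2_Dh: "bilinear_on pair_scale scale scale PiDer UNIV UNIV l2_Dh"
  by (auto simp: bilinear_on_def linear_on_def l2_Dh_def PiDer_iff pair_scale_def DerL_def gl_iff)

lemma bilinear_l2_hD: "bilinear_on scale pair_scale scale UNIV PiDer UNIV l2_hD"
  by (auto simp: bilinear_on_def linear_on_def l2_hD_def PiDer_iff pair_scale_def DerR_def gl_iff)

lemma ad_l2_Dh:
  assumes "x \<in> PiDer" shows "ad (l2_Dh x m) = l2_DD x (ad m)"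
  using assms
  by (cases x) (simp add: PiDer_iff DerL_def ad_def adL_def adR_def l2_Dh_def l2_DD_def
      fun_eq_iff commutator_apply)

text \<open>
  In the left component, \<open>[m, D\<^sup>L b] - D\<^sup>L[m, b] = -[D\<^sup>L m, b]\<close>, which is \<open>[D\<^sup>R m, b]\<close> because
  \<open>D\<^sup>L m + D\<^sup>R m\<close> is in the left centre. The right component is the right derivation rule.
\<close>

lemma ad_l2_hD:
  assumes "x \<in> PiDer" shows "ad (l2_hD m x) = l2_DD (ad m) x"
proof -
  obtain L R where x: "x = (L, R)" by (metis surj_pair)
  have D: "L \<in> DerL" "R \<in> DerR" "L m + R m \<in> Delta"
    using assms by (auto simp: x PiDer_iff)
  have "br (R m) b = - br (L m) b" for b
    using br_Delta_left[OF D(3)] by (simp add: br_simps eq_neg_iff_add_eq_0 add.commute)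
  then show ?thesis
    using D by (simp add: x DerL_def DerR_def ad_def adL_def adR_def l2_hD_def l2_DD_def
        fun_eq_iff commutator_apply)
qed

lemma l2_Dh_ad: "l2_Dh (ad m) n = l2_hD m (ad n)"
  by (simp add: l2_Dh_def l2_hD_def ad_def adL_def adR_def)

lemma l2_DD_leibniz:
  assumes "x \<in> PiDer" "y \<in> PiDer" "z \<in> PiDer"
  shows "l2_DD x (l2_DD y z) = l2_DD (l2_DD x y) z + l2_DD y (l2_DD x z)"
proof -
  obtain L1 R1 L2 R2 L3 R3 where xyz: "x = (L1, R1)" "y = (L2, R2)" "z = (L3, R3)"
    by (metis surj_pair)
  have "additive L1" "additive L2" "additive L3" "additive R3"
    using assms by (auto simp: xyz PiDer_iff DerL_def DerR_def intro: gl_additive)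
  then have "commutator L1 (commutator L2 F) =
      commutator (commutator L1 L2) F + commutator L2 (commutator L1 F)"
    if "F = L3 \<or> F = R3" for F
    using that commutator_leibniz by blast
  from this[of L3] this[of R3] show ?thesis
    by (simp add: xyz l2_DD_def)
qed

text \<open>
  Expanding the commutator leaves \<open>D\<^sub>y\<^sup>R\<close> applied to \<open>D\<^sub>x\<^sup>L m + D\<^sub>x\<^sup>R m \<in> \<Delta>(h)\<close>.
\<close>

lemma l2_hD_l2_DD:
  assumes "x \<in> PiDer" "y \<in> PiDer"
  shows "l2_hD m (l2_DD x y) = l2_hD (l2_hD m x) y + l2_Dh x (l2_hD m y)"
proof -
  obtain L1 R1 L2 R2 where xy: "x = (L1, R1)" "y = (L2, R2)"
    by (metis surj_pair)
  have "R2 \<in> DerR" "L1 m + R1 m \<in> Delta"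
    using assms by (auto simp: xy PiDer_iff)
  then have "R2 (L1 m) + R2 (R1 m) = 0"
    using DerR_Delta[of R2 "L1 m + R1 m"] by (simp add: DerR_def gl_iff)
  then have "R2 (R1 m) = - R2 (L1 m)"
    by (simp add: eq_neg_iff_add_eq_0 add.commute)
  then show ?thesis
    by (simp add: xy l2_hD_def l2_Dh_def l2_DD_def commutator_apply)
qed

lemma l2_Dh_l2_DD: "l2_Dh (l2_DD x y) m = l2_Dh x (l2_Dh y m) - l2_Dh y (l2_Dh x m)"
  by (cases x; cases y) (simp add: l2_Dh_def l2_DD_def commutator_apply)

lemma l2_hD_l2_DD_right: "l2_hD m (l2_DD x y) = l2_Dh x (l2_hD m y) - l2_hD (l2_Dh x m) y"
  by (cases x; cases y) (simp add: l2_Dh_def l2_hD_def l2_DD_def commutator_apply)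

end

theorem proposition3p6:
  fixes scale :: "'k::field \<Rightarrow> 'h::ab_group_add \<Rightarrow> 'h"
    and br :: "'h \<Rightarrow> 'h \<Rightarrow> 'h"
  assumes "leibniz_algebra scale br"
  shows "strict_leibniz_2_algebra scale (leibniz_algebra.pair_scale scale)
    UNIV (leibniz_algebra.PiDer scale br) (leibniz_algebra.ad br)
    l2_DD l2_Dh l2_hD"
proof -
  interpret leibniz_algebra scale br by (rule assms)
  interpret P: vector_space pair_scale by (rule vector_space_pair_scale)
  interpret VP: vector_space_pair scale pair_scale ..
  have ad_0: "ad 0 = 0"
    by (simp add: ad_def adL_def adR_def br_simps zero_prod_def fun_eq_iff)
  have l2_Dh_0: "l2_Dh x 0 = 0" if "x \<in> PiDer" for x
    using that by (cases x) (auto simp: l2_Dh_def PiDer_iff DerL_def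
        intro: additive.zero[OF gl_additive])
  have l2_hD_0: "l2_hD 0 x = 0" if "x \<in> PiDer" for x
    using that by (cases x) (auto simp: l2_hD_def PiDer_iff DerR_def
        intro: additive.zero[OF gl_additive])
  show ?thesis
    unfolding strict_leibniz_2_algebra_def
  proof unfold_locales
    show "trilinear_on pair_scale scale PiDer UNIV (\<lambda>x y z. 0)"
      by (simp add: trilinear_on_def linear_on_def)
  next
    fix x y z assume "x \<in> PiDer" "y \<in> PiDer" "z \<in> PiDer"
    from l2_DD_leibniz[OF this]
    show "ad 0 = l2_DD x (l2_DD y z) - l2_DD (l2_DD x y) z - l2_DD y (l2_DD x z)"
      by (simp add: ad_0)
  next
    fix x y m assume xy: "x \<in> PiDer" "y \<in> PiDer"
    show "0 = l2_Dh x (l2_Dh y m) - l2_Dh (l2_DD x y) m - l2_Dh y (l2_Dh x m)"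
      by (simp add: l2_Dh_l2_DD)
    show "0 = l2_Dh x (l2_hD m y) - l2_hD (l2_Dh x m) y - l2_hD m (l2_DD x y)"
      by (simp add: l2_hD_l2_DD_right)
    show "0 = l2_hD m (l2_DD x y) - l2_hD (l2_hD m x) y - l2_Dh x (l2_hD m y)"
      by (simp add: l2_hD_l2_DD[OF xy])
  next
    fix w x y z assume "w \<in> PiDer" "x \<in> PiDer" "y \<in> PiDer" "z \<in> PiDer"
    then show "l2_Dh w 0 - l2_Dh x 0 + l2_Dh y 0 + l2_hD 0 z - 0 - 0 - 0 + 0 + 0 - 0 = 0"
      by (simp add: l2_Dh_0 l2_hD_0)
  qed (simp_all add: subspace_PiDer linear_ad bilinear_l2_DD bilinear_l2_Dh bilinear_l2_hD
      ad_l2_Dh ad_l2_hD l2_Dh_ad)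
qed

end
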